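(* In the space homogeneous case, the second-order IMEX Runge–Kutta scheme described in the context is positivity preserving, i.e. $f_1^\ell,f_2^\ell\ge0$ implies $f_1^{\ell+1},f_2^{\ell+1}\ge0$, provided that $$\Delta t\le\frac{1}{(1-2\gamma)\,(\nu_{ii}^{(1)}+\nu_{ij}^{(1)})}$$ for $i,j\in\{1,2\}$, $i\ne j$ (and all velocities $\mathbf v$), where $\gamma=1-\frac{\sqrt2}{2}$.
   Context: Species $i\in\{1,2\}$, with $j$ the other index; masses $m_i>0$; $\mathbf v\in\mathbb R^3$; integrals over $\mathbb R^3$; $\Delta t>0$. Let $\mathbf a_i(\mathbf v)=m_i(1,\mathbf v,|\mathbf v|^2)^\top$, $\mathbf a_{12}=m_1(1,0,\mathbf v,|\mathbf v|^2)^\top$, $\mathbf a_{21}=m_2(0,1,\mathbf v,|\mathbf v|^2)^\top$, $\Lambda=\mathbb R\times\mathbb R^3\times(-\infty,0)$, $\Lambda_{12}=\mathbb R\times\mathbb R\times\mathbb R^3\times(-\infty,0)$. Implicit stage: given functions $G_1,G_2$ of $\mathbf v$, a number $\tau>0$ and frequencies $\nu_{ij}(\mathbf v)\ge0$, set $c_i=\frac1{1+\tau(\nu_{ii}+\nu_{ij})}$; let $\boldsymbol\lambda_i$ be the minimizer over $\boldsymbol\alpha\in\Lambda$ of $\int c_i\nu_{ii}e^{\boldsymbol\alpha\cdot\mathbf a_i}d\mathbf v-\boldsymbol\alpha\cdot\int c_i\nu_{ii}G_i\mathbf a_i\,d\mathbf v$ and $\boldsymbol\lambda$ the minimizer over $\boldsymbol\alpha\in\Lambda_{12}$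 of $\int[c_1\nu_{12}e^{\boldsymbol\alpha\cdot\mathbf a_{12}}+c_2\nu_{21}e^{\boldsymbol\alpha\cdot\mathbf a_{21}}]d\mathbf v-\boldsymbol\alpha\cdot\int[c_1\nu_{12}G_1\mathbf a_{12}+c_2\nu_{21}G_2\mathbf a_{21}]d\mathbf v$; put $A_{ii}=e^{\boldsymbol\lambda_i\cdot\mathbf a_i}$, $A_{12}=e^{\boldsymbol\lambda\cdot\mathbf a_{12}}$, $A_{21}=e^{\boldsymbol\lambda\cdot\mathbf a_{21}}$. The result of the stage is $c_iG_i+c_i\tau(\nu_{ii}A_{ii}+\nu_{ij}A_{ij})$. Standing assumption: the integrals are finite and the minimizers exist and are unique. Scheme (no transport): with $\tau=\gamma\Delta t$ and $G_i^{(1)}=f_i^\ell$, let $f_i^{(1)}$ be the result of the implicit stage with data $G^{(1)}_i$ and frequencies $\nu^{(1)}_{ij}\ge0$, with target functions $A^{(1)}_{ij}$. Let $$\mathcal R_i^{(1)}=\nu_{ii}^{(1)}(A_{ii}^{(1)}-f_i^{(1)})+\nu_{ij}^{(1)}(A_{ij}^{(1)}-f_i^{(1)}),\qquad G_i^{(2)}=f_i^\ell+(1-\gamma)\Delta t\,\mathcal R_i^{(1)},$$ let $f_i^{(2)}$ be the result of the implicit stage with data $G_i^{(2)}$, $\tau=\gamma\Delta t$ and frequencies $\nu^{(2)}_{ij}\ge0$, and set $f_i^{\ell+1}=f_i^{(2)}$. The frequencies $\nu^{(r)}_{ij}=\nu_{ij}^{(r)}(\mathbf v)$ are evaluated from (the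 moments of) $G^{(r)}$; they are nonnegative functions of $\mathbf v$. *)

theory Defs
  imports "HOL-Analysis.Analysis"
begin

type_synonym velocity = "real^3"
type_synonym dist_fun = "velocity \<Rightarrow> real"

datatype species = Sp1 | Sp2

fun other :: "species \<Rightarrow> species" where
  "other Sp1 = Sp2"
| "other Sp2 = Sp1"

(* nu i j v is the frequency of collisions of species i with species j. *)
type_synonym freqs = "species \<Rightarrow> species \<Rightarrow> dist_fun"

definition self_inv :: "(species \<Rightarrow> real) \<Rightarrow> species \<Rightarrow> velocity \<Rightarrow> real \<times> velocity \<times> real" where
  "self_inv m i v = m i *\<^sub>R (1, v, (norm v)\<^sup>2)"

(* The vector a_12 for Sp1 and a_21 for Sp2. *)
fun cross_inv :: "(species \<Rightarrow> real) \<Rightarrow> species \<Rightarrow> velocity \<Rightarrow> real \<times> real \<times> velocity \<times> real" where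
  "cross_inv m Sp1 v = m Sp1 *\<^sub>R (1, 0, v, (norm v)\<^sup>2)"
| "cross_inv m Sp2 v = m Sp2 *\<^sub>R (0, 1, v, (norm v)\<^sup>2)"

definition Lambda_self :: "(real \<times> velocity \<times> real) set" where
  "Lambda_self = UNIV \<times> UNIV \<times> {..<0}"

definition Lambda_cross :: "(real \<times> real \<times> velocity \<times> real) set" where
  "Lambda_cross = UNIV \<times> UNIV \<times> UNIV \<times> {..<0}"

definition stage_c :: "real \<Rightarrow> freqs \<Rightarrow> species \<Rightarrow> dist_fun" where
  "stage_c \<tau> \<nu> i v = 1 / (1 + \<tau> * (\<nu> i i v + \<nu> i (other i) v))"

definition self_exp_integrand ::
  "(species \<Rightarrow> real) \<Rightarrow> real \<Rightarrow> freqs \<Rightarrow> species \<Rightarrow> real \<times> velocity \<times> real \<Rightarrow> velocity \<Rightarrow> real" where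
  "self_exp_integrand m \<tau> \<nu> i \<alpha> v = stage_c \<tau> \<nu> i v * \<nu> i i v * exp (\<alpha> \<bullet> self_inv m i v)"

definition self_moment_integrand ::
  "(species \<Rightarrow> real) \<Rightarrow> real \<Rightarrow> freqs \<Rightarrow> (species \<Rightarrow> dist_fun) \<Rightarrow> species \<Rightarrow> velocity
     \<Rightarrow> real \<times> velocity \<times> real" where
  "self_moment_integrand m \<tau> \<nu> G i v = (stage_c \<tau> \<nu> i v * \<nu> i i v * G i v) *\<^sub>R self_inv m i v"

definition self_objective ::
  "(species \<Rightarrow> real) \<Rightarrow> real \<Rightarrow> freqs \<Rightarrow> (species \<Rightarrow> dist_fun) \<Rightarrow> species
     \<Rightarrow> real \<times> velocity \<times> real \<Rightarrow> real" where
  "self_objective m \<tau> \<nu> G i \<alpha> =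
     (LINT v|lebesgue. self_exp_integrand m \<tau> \<nu> i \<alpha> v)
     - \<alpha> \<bullet> (LINT v|lebesgue. self_moment_integrand m \<tau> \<nu> G i v)"

definition cross_exp_integrand ::
  "(species \<Rightarrow> real) \<Rightarrow> real \<Rightarrow> freqs \<Rightarrow> real \<times> real \<times> velocity \<times> real \<Rightarrow> velocity \<Rightarrow> real" where
  "cross_exp_integrand m \<tau> \<nu> \<alpha> v =
     stage_c \<tau> \<nu> Sp1 v * \<nu> Sp1 Sp2 v * exp (\<alpha> \<bullet> cross_inv m Sp1 v)
     + stage_c \<tau> \<nu> Sp2 v * \<nu> Sp2 Sp1 v * exp (\<alpha> \<bullet> cross_inv m Sp2 v)"

definition cross_moment_integrand ::
  "(species \<Rightarrow> real) \<Rightarrow> real \<Rightarrow> freqs \<Rightarrow> (species \<Rightarrow> dist_fun) \<Rightarrow> velocity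
     \<Rightarrow> real \<times> real \<times> velocity \<times> real" where
  "cross_moment_integrand m \<tau> \<nu> G v =
     (stage_c \<tau> \<nu> Sp1 v * \<nu> Sp1 Sp2 v * G Sp1 v) *\<^sub>R cross_inv m Sp1 v
     + (stage_c \<tau> \<nu> Sp2 v * \<nu> Sp2 Sp1 v * G Sp2 v) *\<^sub>R cross_inv m Sp2 v"

definition cross_objective ::
  "(species \<Rightarrow> real) \<Rightarrow> real \<Rightarrow> freqs \<Rightarrow> (species \<Rightarrow> dist_fun)
     \<Rightarrow> real \<times> real \<times> velocity \<times> real \<Rightarrow> real" where
  "cross_objective m \<tau> \<nu> G \<alpha> =
     (LINT v|lebesgue. cross_exp_integrand m \<tau> \<nu> \<alpha> v)
     - \<alpha> \<bullet> (LINT v|lebesgue. cross_moment_integrand m \<tau> \<nu> G v)"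

(* The minimizers below are meaningful under this condition: the integrals are
   finite (lebesgue integrals of non-integrable functions default to 0) and the
   minimizers exist and are unique. *)
definition stage_well_posed ::
  "(species \<Rightarrow> real) \<Rightarrow> real \<Rightarrow> freqs \<Rightarrow> (species \<Rightarrow> dist_fun) \<Rightarrow> bool" where
  "stage_well_posed m \<tau> \<nu> G \<longleftrightarrow>
     (\<forall>i. (\<forall>\<alpha>\<in>Lambda_self. integrable lebesgue (self_exp_integrand m \<tau> \<nu> i \<alpha>))
        \<and> integrable lebesgue (self_moment_integrand m \<tau> \<nu> G i)
        \<and> (\<exists>!\<alpha>. is_arg_min (self_objective m \<tau> \<nu> G i) (\<lambda>\<alpha>. \<alpha> \<in> Lambda_self) \<alpha>))
     \<and> (\<forall>\<alpha>\<in>Lambda_cross. integrable lebesgue (cross_exp_integrand m \<tau> \<nu> \<alpha>))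
     \<and> integrable lebesgue (cross_moment_integrand m \<tau> \<nu> G)
     \<and> (\<exists>!\<alpha>. is_arg_min (cross_objective m \<tau> \<nu> G) (\<lambda>\<alpha>. \<alpha> \<in> Lambda_cross) \<alpha>)"

definition self_multiplier ::
  "(species \<Rightarrow> real) \<Rightarrow> real \<Rightarrow> freqs \<Rightarrow> (species \<Rightarrow> dist_fun) \<Rightarrow> species
     \<Rightarrow> real \<times> velocity \<times> real" where
  "self_multiplier m \<tau> \<nu> G i = arg_min (self_objective m \<tau> \<nu> G i) (\<lambda>\<alpha>. \<alpha> \<in> Lambda_self)"

definition cross_multiplier ::
  "(species \<Rightarrow> real) \<Rightarrow> real \<Rightarrow> freqs \<Rightarrow> (species \<Rightarrow> dist_fun)
     \<Rightarrow> real \<times> real \<times> velocity \<times> real" where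
  "cross_multiplier m \<tau> \<nu> G = arg_min (cross_objective m \<tau> \<nu> G) (\<lambda>\<alpha>. \<alpha> \<in> Lambda_cross)"

(* The target function A_ij; one common multiplier serves A_12 and A_21. *)
definition target ::
  "(species \<Rightarrow> real) \<Rightarrow> real \<Rightarrow> freqs \<Rightarrow> (species \<Rightarrow> dist_fun) \<Rightarrow> species \<Rightarrow> species
     \<Rightarrow> dist_fun" where
  "target m \<tau> \<nu> G i j v =
     (if i = j then exp (self_multiplier m \<tau> \<nu> G i \<bullet> self_inv m i v)
      else exp (cross_multiplier m \<tau> \<nu> G \<bullet> cross_inv m i v))"

definition implicit_stage ::
  "(species \<Rightarrow> real) \<Rightarrow> real \<Rightarrow> freqs \<Rightarrow> (species \<Rightarrow> dist_fun) \<Rightarrow> species \<Rightarrow> dist_fun" where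
  "implicit_stage m \<tau> \<nu> G i v =
     stage_c \<tau> \<nu> i v * G i v
     + stage_c \<tau> \<nu> i v * \<tau> *
         (\<nu> i i v * target m \<tau> \<nu> G i i v + \<nu> i (other i) v * target m \<tau> \<nu> G i (other i) v)"

(* In the scheme the frequencies are a functional N of the current pair of data
   (in applications through its moments): stage r uses N applied to G^(r). *)
type_synonym freq_functional = "(species \<Rightarrow> dist_fun) \<Rightarrow> freqs"

definition imex_R1 ::
  "(species \<Rightarrow> real) \<Rightarrow> freq_functional \<Rightarrow> real \<Rightarrow> real \<Rightarrow> (species \<Rightarrow> dist_fun)
     \<Rightarrow> species \<Rightarrow> dist_fun" where
  "imex_R1 m N \<gamma> \<Delta>t f i v =
     (let \<nu> = N f; f1 = implicit_stage m (\<gamma> * \<Delta>t) \<nu> f; A = target m (\<gamma> * \<Delta>t) \<nu> f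
      in \<nu> i i v * (A i i v - f1 i v) + \<nu> i (other i) v * (A i (other i) v - f1 i v))"

definition imex_G2 ::
  "(species \<Rightarrow> real) \<Rightarrow> freq_functional \<Rightarrow> real \<Rightarrow> real \<Rightarrow> (species \<Rightarrow> dist_fun)
     \<Rightarrow> species \<Rightarrow> dist_fun" where
  "imex_G2 m N \<gamma> \<Delta>t f i v = f i v + (1 - \<gamma>) * \<Delta>t * imex_R1 m N \<gamma> \<Delta>t f i v"

definition imex_step ::
  "(species \<Rightarrow> real) \<Rightarrow> freq_functional \<Rightarrow> real \<Rightarrow> real \<Rightarrow> (species \<Rightarrow> dist_fun)
     \<Rightarrow> species \<Rightarrow> dist_fun" where
  "imex_step m N \<gamma> \<Delta>t f =
     (let G2 = imex_G2 m N \<gamma> \<Delta>t f in implicit_stage m (\<gamma> * \<Delta>t) (N G2) G2)"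

end

theory Submission imports Defs begin

text \<open>
  Write \<open>s = \<nu>\<^sub>i\<^sub>i + \<nu>\<^sub>i\<^sub>j\<close>, \<open>S = \<nu>\<^sub>i\<^sub>i A\<^sub>i\<^sub>i + \<nu>\<^sub>i\<^sub>j A\<^sub>i\<^sub>j\<close> and \<open>c = 1 / (1 + \<gamma> \<Delta>t s)\<close> for the
  quantities of the first stage. Eliminating the implicit value \<open>c f + c \<gamma> \<Delta>t S\<close> from the
  residual leaves \<open>c (S - s f)\<close>, so the data of the second stage are
  \<open>c ((1 - (1 - 2\<gamma>) \<Delta>t s) f + (1 - \<gamma>) \<Delta>t S)\<close>. The time step restriction makes the coefficient
  of \<open>f\<close> nonnegative, and an implicit stage with nonnegative data is a nonnegative combination
  of these data and of exponentials.
\<close>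

text \<open>The gain term of the relaxation operator; \<open>\<tau>\<close> enters only through the
  multipliers of the targets.\<close>

definition gain ::
  "(species \<Rightarrow> real) \<Rightarrow> real \<Rightarrow> freqs \<Rightarrow> (species \<Rightarrow> dist_fun) \<Rightarrow> species \<Rightarrow> dist_fun" where
  "gain m \<tau> \<nu> G i v =
     \<nu> i i v * target m \<tau> \<nu> G i i v + \<nu> i (other i) v * target m \<tau> \<nu> G i (other i) v"

lemma target_nonneg: "target m \<tau> \<nu> G i j v \<ge> 0"
  by (simp add: target_def)

lemma gain_nonneg:
  assumes "\<And>i j v. \<nu> i j v \<ge> 0"
  shows "gain m \<tau> \<nu> G i v \<ge> 0"
  by (simp add: gain_def assms target_nonneg)

lemma stage_c_nonneg:
  assumes "\<tau> \<ge> 0" and "\<And>i j v. \<nu> i j v \<ge> 0"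
  shows "stage_c \<tau> \<nu> i v \<ge> 0"
  by (simp add: stage_c_def assms)

lemma implicit_stage_nonneg:
  assumes "\<tau> \<ge> 0" and "\<And>i j v. \<nu> i j v \<ge> 0" and "G i v \<ge> 0"
  shows "implicit_stage m \<tau> \<nu> G i v \<ge> 0"
  unfolding implicit_stage_def gain_def[symmetric]
  by (simp add: assms stage_c_nonneg gain_nonneg)

lemma imex_G2_eq:
  assumes "\<gamma> * \<Delta>t \<ge> 0" and "\<And>i j v. N f i j v \<ge> 0"
  shows "imex_G2 m N \<gamma> \<Delta>t f i v = stage_c (\<gamma> * \<Delta>t) (N f) i v *
    ((1 - (1 - 2 * \<gamma>) * \<Delta>t * (N f i i v + N f i (other i) v)) * f i v
     + (1 - \<gamma>) * \<Delta>t * gain m (\<gamma> * \<Delta>t) (N f) f i v)"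
proof -
  define s where "s = N f i i v + N f i (other i) v"
  define S where "S = gain m (\<gamma> * \<Delta>t) (N f) f i v"
  define c where "c = stage_c (\<gamma> * \<Delta>t) (N f) i v"
  have "s \<ge> 0"
    by (simp add: s_def assms(2))
  then have "1 + \<gamma> * \<Delta>t * s > 0"
    using mult_nonneg_nonneg[OF assms(1)] by (simp add: add_pos_nonneg)
  then have c: "c * (1 + \<gamma> * \<Delta>t * s) = 1"
    by (simp add: c_def stage_c_def s_def)
  have "imex_R1 m N \<gamma> \<Delta>t f i v = S - s * (c * f i v + c * (\<gamma> * \<Delta>t) * S)"
    by (simp add: imex_R1_def Let_def implicit_stage_def gain_def s_def S_def c_def algebra_simps)
  \<comment> \<open>Multiplying \<open>S\<close> by this factor, which equals 1, makes the terms in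
    \<open>s * S\<close> cancel.\<close>
  also have "\<dots> = S * (c * (1 + \<gamma> * \<Delta>t * s)) - s * (c * f i v + c * (\<gamma> * \<Delta>t) * S)"
    by (simp add: c)
  also have "\<dots> = c * (S - s * f i v)"
    by (simp add: algebra_simps)
  \<comment> \<open>The same factor on \<open>f i v\<close> contributes
    \<open>\<gamma> * \<Delta>t * s\<close> against the loss
    \<open>(1 - \<gamma>) * \<Delta>t * s\<close>; hence the constant
    \<open>1 - 2 * \<gamma>\<close>.\<close>
  finally have "imex_G2 m N \<gamma> \<Delta>t f i v =
      f i v * (c * (1 + \<gamma> * \<Delta>t * s)) + (1 - \<gamma>) * \<Delta>t * (c * (S - s * f i v))"
    by (simp add: imex_G2_def c)
  then show ?thesis
    unfolding s_def[symmetric] S_def[symmetric] c_def[symmetric] by (simp add: algebra_simps)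
qed

lemma imex_G2_nonneg:
  assumes "0 \<le> \<gamma>" and "\<gamma> \<le> 1" and "\<Delta>t \<ge> 0" and "\<And>i j v. N f i j v \<ge> 0" and "f i v \<ge> 0"
    and "(1 - 2 * \<gamma>) * \<Delta>t * (N f i i v + N f i (other i) v) \<le> 1"
  shows "imex_G2 m N \<gamma> \<Delta>t f i v \<ge> 0"
  using assms by (simp add: imex_G2_eq stage_c_nonneg gain_nonneg)

theorem proposition5p2:
  fixes m :: "species \<Rightarrow> real" and N :: freq_functional
    and \<gamma> \<Delta>t :: real and f :: "species \<Rightarrow> dist_fun"
  assumes mass_pos: "\<And>i. m i > 0"
    and dt_pos: "\<Delta>t > 0"
    and gamma: "\<gamma> = 1 - sqrt 2 / 2"
    and freq1_nonneg: "\<And>i j v. N f i j v \<ge> 0"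
    and freq2_nonneg: "\<And>i j v. N (imex_G2 m N \<gamma> \<Delta>t f) i j v \<ge> 0"
    and stage1: "stage_well_posed m (\<gamma> * \<Delta>t) (N f) f"
    and stage2: "stage_well_posed m (\<gamma> * \<Delta>t) (N (imex_G2 m N \<gamma> \<Delta>t f)) (imex_G2 m N \<gamma> \<Delta>t f)"
    and time_step: "\<And>i j v. i \<noteq> j \<Longrightarrow> N f i i v + N f i j v > 0 \<Longrightarrow>
          \<Delta>t \<le> 1 / ((1 - 2 * \<gamma>) * (N f i i v + N f i j v))"
    and f_nonneg: "\<And>i v. f i v \<ge> 0"
  shows "\<forall>i v. imex_step m N \<gamma> \<Delta>t f i v \<ge> 0"
proof (intro allI)
  fix i v
  have "sqrt 2 < (2 :: real)"
    by (simp add: real_less_lsqrt)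
  \<comment> \<open>Here \<open>1 - 2 * \<gamma>\<close> is \<open>sqrt 2 - 1\<close>.\<close>
  then have \<gamma>: "0 \<le> \<gamma>" "\<gamma> \<le> 1" "0 < 1 - 2 * \<gamma>"
    by (simp_all add: gamma)
  define s where "s = N f i i v + N f i (other i) v"
  have "s \<ge> 0"
    by (simp add: s_def freq1_nonneg)
  moreover have "\<Delta>t \<le> 1 / ((1 - 2 * \<gamma>) * s)" if "s > 0"
    using time_step[of i "other i" v] that by (cases i) (simp_all add: s_def)
  \<comment> \<open>Without collisions, \<open>s = 0\<close>, \<open>\<Delta>t\<close> is
    unrestricted but the left side vanishes.\<close>
  ultimately have "(1 - 2 * \<gamma>) * \<Delta>t * s \<le> 1"
    using \<gamma>(3) by (cases "s = 0") (simp_all add: pos_le_divide_eq mult_ac)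
  then have "imex_G2 m N \<gamma> \<Delta>t f i v \<ge> 0"
    unfolding s_def using \<gamma> dt_pos freq1_nonneg f_nonneg by (intro imex_G2_nonneg) simp_all
  then show "imex_step m N \<gamma> \<Delta>t f i v \<ge> 0"
    using \<gamma> dt_pos freq2_nonneg by (simp add: imex_step_def Let_def implicit_stage_nonneg)
qed

end
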